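(* For every positive integer $n$, $$k(S_n) \leq \prod_{p \mid |S_n|} k_p(S_n) \quad\text{and}\quad k(A_n) \leq \prod_{p \mid |A_n|} k_p(A_n),$$ where each product runs over the prime numbers $p$ dividing the order of the indicated group (an empty product equals $1$).
   Context: $S_n$ and $A_n$ denote the symmetric and alternating groups on $n$ points, so $|S_n| = n!$, $|A_n| = n!/2$ for $n \geq 2$, and $|A_1| = 1$. For a finite group $H$, $k(H)$ denotes the number of conjugacy classes of $H$. For a finite group $G$ and a prime $p$, $k_p(G)$ denotes $k(P)$, where $P$ is a Sylow $p$-subgroup of $G$ (this is independent of the choice of $P$, as all Sylow $p$-subgroups of $G$ are isomorphic). *)

theory Defs
  imports
    "HOL-Algebra.Sym_Groups"
    "HOL-Algebra.Sylow"
    "HOL-Algebra.Group_Action"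
begin

definition conjugacy_classes :: "('a, 'b) monoid_scheme \<Rightarrow> 'a set set" where
  "conjugacy_classes G =
     orbits G (carrier G) (\<lambda>g. \<lambda>h \<in> carrier G. g \<otimes>\<^bsub>G\<^esub> h \<otimes>\<^bsub>G\<^esub> (inv\<^bsub>G\<^esub> g))"

definition class_number :: "('a, 'b) monoid_scheme \<Rightarrow> nat" where
  "class_number G = card (conjugacy_classes G)"

definition sylow_subgroup :: "('a, 'b) monoid_scheme \<Rightarrow> nat \<Rightarrow> 'a set \<Rightarrow> bool" where
  "sylow_subgroup G p P \<longleftrightarrow>
     prime p \<and> subgroup P G \<and> card P = p ^ multiplicity p (order G)"

(* For a finite group and a prime p the choice is always possible, by sylow_subgroup_exists
   below, and the value does not depend on it, since all Sylow p-subgroups are conjugate. *)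
definition sylow_class_number :: "nat \<Rightarrow> ('a, 'b) monoid_scheme \<Rightarrow> nat" where
  "sylow_class_number p G = class_number (G\<lparr>carrier := (SOME P. sylow_subgroup G p P)\<rparr>)"

lemma sylow_subgroup_exists:
  assumes "group G" "finite (carrier G)" "prime p"
  shows "\<exists>P. sylow_subgroup G p P"
proof -
  have "p ^ multiplicity p (order G) dvd order G"
    by (rule multiplicity_dvd)
  then obtain m where "order G = p ^ multiplicity p (order G) * m"
    by (elim dvdE)
  from sylow_thm[OF assms(3,1) this assms(2)] assms(3) show ?thesis
    unfolding sylow_subgroup_def by blast
qed

end

theory Submission
  imports Defs "HOL-Number_Theory.Fib" "HOL-Analysis.Harmonic_Numbers"
begin

text \<open>A nontrivial \<open>p\<close>-group has at least \<open>p\<close> conjugacy classes, so for \<open>S\<^sub>n\<close>, and for \<open>A\<^sub>n\<close> with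
  \<open>n \<ge> 4\<close>, the product of the Sylow class numbers is at least the product \<open>n#\<close> of the primes up to
  \<open>n\<close>. The number of partitions of \<open>n\<close> is at most the Fibonacci number \<open>F(n + 1)\<close>, hence
  \<open>k(S\<^sub>n) \<le> F(n + 1)\<close> and \<open>k(A\<^sub>n) \<le> 2 F(n + 1)\<close>. Since \<open>F(n + 1)\<close> grows like the powers of the golden
  ratio, the Chebyshev-type estimate \<open>2^(n - 1) \<le> lcm(1, \<dots>, n) \<le> n# n^\<pi>(\<surd>n)\<close> gives
  \<open>2 F(n + 1) \<le> n#\<close> for large \<open>n\<close>, and a few explicit primes do so for the remaining \<open>n \<ge> 5\<close>. This
  leaves \<open>A\<^sub>3\<close>, of prime order, and \<open>A\<^sub>4\<close>, where the abelian Sylow 2-subgroup contributes 4.\<close>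

section \<open>Partitions and cycle types\<close>

definition partitions :: "nat \<Rightarrow> nat list set" where
  "partitions n = {xs. sorted xs \<and> 0 \<notin> set xs \<and> sum_list xs = n}"

lemma partitions_0: "partitions 0 = {[]}"
proof -
  have "xs = []" if "xs \<in> partitions 0" for xs
    using that by (cases xs) (auto simp: partitions_def)
  then show ?thesis by (auto simp: partitions_def)
qed

lemma partitions_1: "partitions (Suc 0) = {[1]}"
proof -
  have "xs = [1]" if xs: "xs \<in> partitions (Suc 0)" for xs
  proof (cases xs)
    case (Cons a ys)
    then have "a = 1" "ys \<in> partitions 0"
      using xs by (auto simp: partitions_def add_is_1)
    then show ?thesis using Cons by (simp add: partitions_0)
  qed (use xs in \<open>simp add: partitions_def\<close>)
  then show ?thesis by (auto simp: partitions_def)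
qed

text \<open>A partition without parts equal to 1 becomes a partition of \<open>n\<close> when its least part \<open>a\<close> is
  replaced by \<open>a - 2\<close> ones; their number recovers \<open>a\<close>.\<close>

lemma partitions_Suc_Suc_subset:
  "partitions (Suc (Suc n)) \<subseteq> Cons 1 ` partitions (Suc n) \<union>
     (\<lambda>xs. (2 + length (takeWhile (\<lambda>x. x = 1) xs)) # dropWhile (\<lambda>x. x = 1) xs) ` partitions n"
    (is "_ \<subseteq> _ \<union> ?g ` _")
proof
  fix xs assume xs: "xs \<in> partitions (Suc (Suc n))"
  then obtain a ys where Cons: "xs = a # ys" by (cases xs) (auto simp: partitions_def)
  show "xs \<in> Cons 1 ` partitions (Suc n) \<union> ?g ` partitions n"
  proof (cases "a = 1")
    case True
    then have "ys \<in> partitions (Suc n)" using xs Cons by (auto simp: partitions_def)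
    then show ?thesis using Cons True by auto
  next
    case False
    then have a: "a \<ge> 2" using xs Cons by (cases a) (auto simp: partitions_def)
    then have ys: "\<forall>y\<in>set ys. y \<ge> 2" using xs Cons by (force simp: partitions_def)
    define zs where "zs = replicate (a - 2) 1 @ ys"
    have "zs \<in> partitions n"
      using xs Cons a ys by (auto simp: partitions_def zs_def sorted_append sum_list_replicate)
    moreover have "takeWhile (\<lambda>x. x = 1) ys = []" "dropWhile (\<lambda>x. x = 1) ys = ys"
      using ys by (cases ys; auto)+
    then have "takeWhile (\<lambda>x. x = 1) zs = replicate (a - 2) 1" "dropWhile (\<lambda>x. x = 1) zs = ys"
      by (simp_all add: zs_def takeWhile_append dropWhile_append)
    then have "?g zs = xs" using Cons a by simp
    ultimately show ?thesis by blast
  qed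
qed

text \<open>The covering by two images reproduces the Fibonacci recurrence. Finiteness is carried
  through the induction because the cardinality estimates for the union and the images depend on
  it.\<close>

lemma finite_partitions_and_card_le_fib:
  "finite (partitions n) \<and> card (partitions n) \<le> fib (Suc n)"
proof (induction n rule: fib.induct)
  case (3 n)
  let ?g = "\<lambda>xs. (2 + length (takeWhile (\<lambda>x. x = 1) xs)) # dropWhile (\<lambda>x. x = (1::nat)) xs"
  let ?U = "Cons 1 ` partitions (Suc n) \<union> ?g ` partitions n"
  have fin: "finite ?U" using 3 by blast
  have "card (partitions (Suc (Suc n))) \<le> card ?U"
    by (rule card_mono[OF fin partitions_Suc_Suc_subset])
  also have "\<dots> \<le> card (Cons 1 ` partitions (Suc n)) + card (?g ` partitions n)"
    by (rule card_Un_le)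
  also have "\<dots> \<le> card (partitions (Suc n)) + card (partitions n)"
    using 3 by (intro add_mono card_image_le) auto
  also have "\<dots> \<le> fib (Suc (Suc (Suc n)))" using 3 by simp
  finally show ?case using finite_subset[OF partitions_Suc_Suc_subset fin] by simp
qed (simp_all add: partitions_0 partitions_1)

lemmas finite_partitions = finite_partitions_and_card_le_fib[THEN conjunct1]
lemmas card_partitions_le_fib = finite_partitions_and_card_le_fib[THEN conjunct2]

section \<open>Cycle types as invariants that separate conjugacy classes\<close>

text \<open>Fixed points occur as singleton lists, so the lists exhaust \<open>S\<close> and their
  lengths form a partition of its cardinality.\<close>

definition cycle_list :: "'a set \<Rightarrow> ('a \<Rightarrow> 'a) \<Rightarrow> 'a list list \<Rightarrow> bool" where
  "cycle_list S p css \<longleftrightarrow> distinct (concat css) \<and> set (concat css) = S \<and> [] \<notin> set css \<and>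
     (\<forall>cs\<in>set css. map p cs = rotate1 cs)"

text \<open>The supports are disjoint: the old permutation fixes the entries of the new cycle, and
  the new cycle fixes the entries of the old ones. An empty new cycle is dropped.\<close>

lemma cycle_decomp_imp_cycle_list:
  assumes "cycle_decomp S p"
  shows "p permutes S \<and> (\<exists>css. cycle_list S p css)"
  using assms
proof induction
  case empty
  have "cycle_list {} id []" by (simp add: cycle_list_def)
  then show ?case using permutes_id by blast
next
  case (comp I p cs)
  then obtain css where css: "cycle_list I p css" and p: "p permutes I" by blast
  let ?q = "cycle_of_list cs \<circ> p"
  have q: "?q permutes set cs \<union> I"
    using cycle_permutes[of cs] p
    by (intro permutes_compose) (auto intro: permutes_subset)
  show ?case
  proof (cases "cs = []")
    case True
    then show ?thesis using css p by auto
  next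
    case False
    have "map ?q cs = map (cycle_of_list cs) cs"
      using p comp.hyps(3) by (auto simp: permutes_def)
    also have "\<dots> = rotate1 cs" using cyclic_rotation[OF comp.hyps(2), of 1] by simp
    finally have "map ?q cs = rotate1 cs" .
    moreover have "map ?q ds = rotate1 ds" if "ds \<in> set css" for ds
    proof -
      have "map ?q ds = map (cycle_of_list cs) (map p ds)" by simp
      also have "map p ds = rotate1 ds" using css that by (simp add: cycle_list_def)
      also have "map (cycle_of_list cs) (rotate1 ds) = rotate1 ds"
        using css that comp.hyps(3) by (intro map_idI id_outside_supp) (auto simp: cycle_list_def)
      finally show ?thesis .
    qed
    ultimately have "cycle_list (set cs \<union> I) ?q (cs # css)"
      using css comp.hyps(2,3) False by (auto simp: cycle_list_def)
    then show ?thesis using q by blast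
  qed
qed

text \<open>Any sorted decomposition serves, because the counting below asks only that equal values
  force conjugacy.\<close>

definition cycle_type :: "'a set \<Rightarrow> ('a \<Rightarrow> 'a) \<Rightarrow> nat list" where
  "cycle_type S p = map length (SOME css. cycle_list S p css \<and> sorted (map length css))"

lemma cycle_type_witness:
  assumes "p permutes S" "finite S"
  obtains css where "cycle_list S p css" "sorted (map length css)" "cycle_type S p = map length css"
proof -
  obtain css where css: "cycle_list S p css"
    using cycle_decomp_imp_cycle_list[OF cycle_decomposition[OF assms]] by blast
  have "mset (concat (sort_key length css)) = mset (concat css)"
    by (simp add: mset_concat flip: sum_mset_sum_list)
  then have "distinct (concat (sort_key length css)) = distinct (concat css)"
    by (rule mset_eq_imp_distinct_iff)
  then have "cycle_list S p (sort_key length css)"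
    using css by (simp add: cycle_list_def)
  then have "\<exists>css. cycle_list S p css \<and> sorted (map length css)"
    using sorted_sort_key by blast
  from someI_ex[OF this] show thesis using that unfolding cycle_type_def by blast
qed

lemma cycle_type_in_partitions:
  assumes "p permutes S" "finite S"
  shows "cycle_type S p \<in> partitions (card S)"
proof -
  obtain css where css: "cycle_list S p css" "sorted (map length css)" "cycle_type S p = map length css"
    using assms by (rule cycle_type_witness)
  have "sum_list (map length css) = length (concat css)" by (simp add: length_concat)
  also have "\<dots> = card S" using css(1) distinct_card unfolding cycle_list_def by fastforce
  finally show ?thesis using css by (auto simp: partitions_def cycle_list_def)
qed

lemma permutes_map_exists:
  assumes "distinct xs" "distinct ys" "set xs = S" "set ys = S"
  shows "\<exists>h. h permutes S \<and> map h xs = ys"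
proof -
  have len: "length xs = length ys" using assms by (metis distinct_card)
  define h where "h x = (if x \<in> S then the (map_of (zip xs ys) x) else x)" for x
  have nth: "h (xs ! i) = ys ! i" if "i < length xs" for i
    using that len assms(1,3) by (auto simp: h_def map_of_zip_nth)
  then have map: "map h xs = ys" using len by (intro nth_equalityI) auto
  then have "inj_on h S" "h ` S = S" using assms by (metis distinct_map, metis set_map)
  then have "h permutes S" by (intro bij_imp_permutes) (auto simp: bij_betw_def h_def)
  then show ?thesis using map by blast
qed

text \<open>Sorting pairs off cycles of equal length. Mapping each cycle entry by entry onto its
  partner intertwines \<open>p\<close> and \<open>q\<close>, since both act by rotating their
  lists.\<close>

lemma cycle_type_eq_imp_conjugate:
  assumes "p permutes S" "q permutes S" "finite S" "cycle_type S p = cycle_type S q"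
  obtains h where "h permutes S" "h \<circ> p = q \<circ> h"
proof -
  obtain css where css: "cycle_list S p css" "cycle_type S p = map length css"
    using assms(1,3) by (rule cycle_type_witness)
  obtain dss where dss: "cycle_list S q dss" "cycle_type S q = map length dss"
    using assms(2,3) by (rule cycle_type_witness)
  have len: "map length css = map length dss" using assms(4) css(2) dss(2) by simp
  obtain h where h: "h permutes S" "map h (concat css) = concat dss"
    using permutes_map_exists[of "concat css" "concat dss" S] css(1) dss(1)
    by (auto simp only: cycle_list_def)
  have "concat (map (map h) css) = concat dss" using h(2) by (simp add: map_concat)
  moreover have "length (map (map h) css) = length dss" using arg_cong[OF len, of length] by simp
  \<comment> \<open>Equal block lengths make the splitting of the concatenation unique, so
    \<open>h\<close> respects the individual cycles.\<close>
  moreover have "\<forall>(cs, ds)\<in>set (zip (map (map h) css) dss). length cs = length ds"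
  proof -
    have "length (css ! i) = length (dss ! i)" if "i < length css" "i < length dss" for i
      using arg_cong[OF len, of "\<lambda>ls. ls ! i"] that by simp
    then show ?thesis by (auto simp: set_zip)
  qed
  ultimately have maps: "map (map h) css = dss" using concat_injective by blast
  have "h (p x) = q (h x)" for x
  proof (cases "x \<in> S")
    case True
    then obtain cs where cs: "cs \<in> set css" "x \<in> set cs"
      using css(1) by (auto simp: cycle_list_def)
    have "map h cs \<in> set dss" using cs(1) maps by auto
    then have "map q (map h cs) = rotate1 (map h cs)" using dss(1) by (auto simp: cycle_list_def)
    also have "\<dots> = map h (map p cs)" using css(1) cs(1) by (auto simp: cycle_list_def rotate1_map)
    finally show ?thesis using cs(2) by auto
  next
    case False
    then show ?thesis using assms(1,2) h(1) by (simp add: permutes_def)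
  qed
  then show thesis using that h(1) by (auto simp: fun_eq_iff)
qed

section \<open>Class numbers\<close>

context group
begin

definition conj_rel :: "'a \<Rightarrow> 'a \<Rightarrow> bool" where
  "conj_rel x y \<longleftrightarrow> (\<exists>g\<in>carrier G. y = g \<otimes> x \<otimes> inv g)"

lemma conjugacy_class_eq:
  assumes "x \<in> carrier G" "y \<in> carrier G" "conj_rel x y"
  shows "orbit G (\<lambda>g. \<lambda>h\<in>carrier G. g \<otimes> h \<otimes> inv g) x = orbit G (\<lambda>g. \<lambda>h\<in>carrier G. g \<otimes> h \<otimes> inv g) y"
proof -
  let ?o = "orbit G (\<lambda>g. \<lambda>h\<in>carrier G. g \<otimes> h \<otimes> inv g)"
  interpret group_action G "carrier G" "\<lambda>g. \<lambda>h\<in>carrier G. g \<otimes> h \<otimes> inv g"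
    by (rule action_by_conjugation)
  have "y \<in> ?o x" using assms by (auto simp: orbit_def conj_rel_def)
  moreover have "y \<in> ?o y" by (rule orbit_refl[OF assms(2)])
  moreover have "?o x \<in> orbits G (carrier G) (\<lambda>g. \<lambda>h\<in>carrier G. g \<otimes> h \<otimes> inv g)"
    "?o y \<in> orbits G (carrier G) (\<lambda>g. \<lambda>h\<in>carrier G. g \<otimes> h \<otimes> inv g)"
    using assms by (auto simp: orbits_def)
  ultimately show ?thesis using disjoint_union by blast
qed

text \<open>Sending \<open>t\<close> to the class of a chosen element with \<open>f\<close>-value
  \<open>t\<close> reaches every class, because elements with the same value are conjugate.\<close>

lemma class_number_le_card:
  assumes "finite T" "f ` carrier G \<subseteq> T"
    and "\<And>x y. \<lbrakk>x \<in> carrier G; y \<in> carrier G; f x = f y\<rbrakk> \<Longrightarrow> conj_rel x y"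
  shows "class_number G \<le> card T"
proof -
  let ?o = "orbit G (\<lambda>g. \<lambda>h\<in>carrier G. g \<otimes> h \<otimes> inv g)"
  have "conjugacy_classes G \<subseteq> (\<lambda>t. ?o (SOME x. x \<in> carrier G \<and> f x = t)) ` T"
  proof
    fix C assume "C \<in> conjugacy_classes G"
    then obtain x where x: "x \<in> carrier G" "C = ?o x"
      by (auto simp: conjugacy_classes_def orbits_def)
    define y where "y = (SOME y. y \<in> carrier G \<and> f y = f x)"
    have "y \<in> carrier G \<and> f y = f x" unfolding y_def by (rule someI[of _ x]) (simp add: x)
    then have "?o x = ?o y" using conjugacy_class_eq[of x y] assms(3)[of x y] x(1) by simp
    then show "C \<in> (\<lambda>t. ?o (SOME x. x \<in> carrier G \<and> f x = t)) ` T"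
      using x assms(2) unfolding y_def by blast
  qed
  then have "class_number G \<le> card ((\<lambda>t. ?o (SOME x. x \<in> carrier G \<and> f x = t)) ` T)"
    unfolding class_number_def using assms(1) by (intro card_mono) auto
  also have "\<dots> \<le> card T" using assms(1) by (rule card_image_le)
  finally show ?thesis .
qed

lemma class_number_le_order:
  assumes "finite (carrier G)"
  shows "class_number G \<le> order G"
  unfolding order_def
proof (rule class_number_le_card[where f = id])
  fix x y assume "x \<in> carrier G" "y \<in> carrier G" "id x = id y"
  then show "conj_rel x y" unfolding conj_rel_def by (intro bexI[of _ \<one>]) auto
qed (use assms in auto)

text \<open>Burnside's lemma for conjugation: the points fixed by \<open>g\<close> form its
  centralizer.\<close>

lemma class_number_mult_order:
  assumes "finite (carrier G)"
  shows "class_number G * order G = (\<Sum>g\<in>carrier G. card {h \<in> carrier G. g \<otimes> h = h \<otimes> g})"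
proof -
  interpret group_action G "carrier G" "\<lambda>g. \<lambda>h\<in>carrier G. g \<otimes> h \<otimes> inv g"
    by (rule action_by_conjugation)
  have "invariants (carrier G) (\<lambda>g. \<lambda>h\<in>carrier G. g \<otimes> h \<otimes> inv g) g
      = {h \<in> carrier G. g \<otimes> h = h \<otimes> g}" if "g \<in> carrier G" for g
    using that by (auto simp: invariants_def inv_solve_right')
  then show ?thesis
    using burnside[OF assms assms] by (simp add: class_number_def conjugacy_classes_def)
qed

lemma subgroup_centralizer:
  assumes "g \<in> carrier G"
  shows "subgroup {h \<in> carrier G. g \<otimes> h = h \<otimes> g} G"
proof (rule subgroupI)
  fix a assume "a \<in> {h \<in> carrier G. g \<otimes> h = h \<otimes> g}"
  then have a: "a \<in> carrier G" "g \<otimes> a = a \<otimes> g" by auto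
  have "g \<otimes> inv a = inv a \<otimes> (a \<otimes> g) \<otimes> inv a" using a(1) assms by (simp flip: m_assoc)
  also have "\<dots> = inv a \<otimes> (g \<otimes> a) \<otimes> inv a" by (simp only: a(2))
  also have "\<dots> = inv a \<otimes> g" using a(1) assms by (simp add: m_assoc)
  finally show "inv a \<in> {h \<in> carrier G. g \<otimes> h = h \<otimes> g}" using a by simp
next
  fix a b assume ab: "a \<in> {h \<in> carrier G. g \<otimes> h = h \<otimes> g}" "b \<in> {h \<in> carrier G. g \<otimes> h = h \<otimes> g}"
  have "g \<otimes> (a \<otimes> b) = a \<otimes> g \<otimes> b" using ab assms by (simp flip: m_assoc)
  also have "\<dots> = a \<otimes> b \<otimes> g" using ab assms by (simp add: m_assoc)
  finally show "a \<otimes> b \<in> {h \<in> carrier G. g \<otimes> h = h \<otimes> g}" using ab by simp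
qed (use assms in \<open>auto intro: exI[of _ \<one>]\<close>)

text \<open>By Burnside's formula the class number is the average order of a centralizer, and every
  centralizer of a nontrivial \<open>p\<close>-group has order at least \<open>p\<close>.\<close>

lemma prime_le_class_number:
  assumes "prime p" "order G = p ^ k" "k > 0"
  shows "p \<le> class_number G"
proof -
  let ?C = "\<lambda>g. {h \<in> carrier G. g \<otimes> h = h \<otimes> g}"
  have "order G > 0" using assms(1,2) by (simp add: prime_gt_0_nat)
  then have fin: "finite (carrier G)" by (simp add: order_gt_0_iff_finite)
  have le: "p \<le> card (?C g)" if g: "g \<in> carrier G" for g
  proof -
    have "card (?C g) dvd p ^ k"
      unfolding assms(2)[symmetric] lagrange[OF subgroup_centralizer[OF g], symmetric]
      by (rule dvd_triv_right)
    then obtain i where i: "card (?C g) = p ^ i"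
      using assms(1) by (auto simp: divides_primepow_nat)
    \<comment> \<open>A trivial centralizer contains \<open>g\<close>, so \<open>g\<close> would be
      the identity, whose centralizer is the whole nontrivial group.\<close>
    have "i \<noteq> 0"
    proof
      assume "i = 0"
      then have "card (?C g) = 1" using i by simp
      moreover have "\<one> \<in> ?C g" "g \<in> ?C g" using g by auto
      ultimately have "g = \<one>" by (metis card_1_singletonE singletonD)
      then have "?C g = carrier G" by auto
      then have "p ^ k = 1" using \<open>card (?C g) = 1\<close> assms(2) by (simp add: order_def)
      then show False using assms(1,3) by (simp add: prime_nat_iff)
    qed
    then have "p ^ 1 \<le> p ^ i" using prime_ge_1_nat[OF assms(1)] by (intro power_increasing) auto
    then show ?thesis using i by simp
  qed
  have "order G * p = (\<Sum>g\<in>carrier G. p)" by (simp add: order_def)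
  also have "\<dots> \<le> (\<Sum>g\<in>carrier G. card (?C g))" by (intro sum_mono le)
  also have "\<dots> = order G * class_number G"
    using class_number_mult_order[OF fin] by (simp add: mult.commute)
  finally show ?thesis using \<open>order G > 0\<close> by simp
qed

text \<open>If \<open>x\<close> and \<open>y\<close> did not commute, then the identity,
  \<open>x\<close>, \<open>y\<close> and the two products would be five distinct elements.\<close>

lemma order_le_4_imp_comm:
  assumes "finite (carrier G)" "order G \<le> 4" "x \<in> carrier G" "y \<in> carrier G"
  shows "x \<otimes> y = y \<otimes> x"
proof (rule ccontr)
  assume ne: "x \<otimes> y \<noteq> y \<otimes> x"
  have "x \<noteq> \<one>" "y \<noteq> \<one>" "x \<noteq> y" using ne assms by auto
  moreover have "x \<otimes> y \<noteq> \<one>" "y \<otimes> x \<noteq> \<one>" using ne assms inv_comm by metis+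
  ultimately have "distinct [\<one>, x, y, x \<otimes> y, y \<otimes> x]" using ne assms by auto
  then have "card {\<one>, x, y, x \<otimes> y, y \<otimes> x} = 5" using distinct_card by fastforce
  moreover have "card {\<one>, x, y, x \<otimes> y, y \<otimes> x} \<le> order G"
    unfolding order_def using assms by (intro card_mono) auto
  ultimately show False using assms(2) by simp
qed

lemma comm_imp_class_number_eq_order:
  assumes "finite (carrier G)" "\<And>x y. \<lbrakk>x \<in> carrier G; y \<in> carrier G\<rbrakk> \<Longrightarrow> x \<otimes> y = y \<otimes> x"
  shows "class_number G = order G"
proof -
  have "class_number G * order G = (\<Sum>g\<in>carrier G. card (carrier G))"
    unfolding class_number_mult_order[OF assms(1)] using assms(2)
    by (intro sum.cong refl arg_cong[where f = card]) auto
  then have "class_number G * order G = order G * order G" by (simp add: order_def)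
  moreover have "order G > 0" using assms(1) by (simp add: order_gt_0_iff_finite)
  ultimately show ?thesis by simp
qed

lemma sylow_class_number_witness:
  assumes "finite (carrier G)" "prime p"
  obtains P where "group (G\<lparr>carrier := P\<rparr>)" "order (G\<lparr>carrier := P\<rparr>) = p ^ multiplicity p (order G)"
    "sylow_class_number p G = class_number (G\<lparr>carrier := P\<rparr>)"
proof -
  define P where "P = (SOME P. sylow_subgroup G p P)"
  have "sylow_subgroup G p P"
    unfolding P_def using sylow_subgroup_exists[OF is_group assms] by (rule someI_ex)
  then have "subgroup P G" "card P = p ^ multiplicity p (order G)"
    by (simp_all add: sylow_subgroup_def)
  moreover have "sylow_class_number p G = class_number (G\<lparr>carrier := P\<rparr>)"
    by (simp add: sylow_class_number_def P_def)
  ultimately show thesis using that[of P] subgroup_imp_group by (simp add: order_def)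
qed

lemma prime_le_sylow_class_number:
  assumes "finite (carrier G)" "prime p" "p dvd order G"
  shows "p \<le> sylow_class_number p G"
proof -
  obtain P where P: "group (G\<lparr>carrier := P\<rparr>)" "order (G\<lparr>carrier := P\<rparr>) = p ^ multiplicity p (order G)"
    "sylow_class_number p G = class_number (G\<lparr>carrier := P\<rparr>)"
    using assms(1,2) by (rule sylow_class_number_witness)
  have "order G > 0" using assms(1) by (simp add: order_gt_0_iff_finite)
  then have "multiplicity p (order G) > 0"
    using assms(2,3) by (simp add: prime_multiplicity_gt_zero_iff)
  then show ?thesis using group.prime_le_class_number[OF P(1) assms(2) P(2)] P(3) by simp
qed

end

section \<open>Upper bounds for the class numbers of \<open>S_n\<close> and
  \<open>A_n\<close>\<close>

lemma finite_carrier_sym_group: "finite (carrier (sym_group n))"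
  by (simp add: sym_group_def finite_permutations)

lemma finite_carrier_alt_group: "finite (carrier (alt_group n))"
  by (rule finite_subset[OF _ finite_carrier_sym_group[of n]])
    (auto simp: sym_group_carrier alt_group_carrier)

lemma class_number_sym_group_le: "class_number (sym_group n) \<le> card (partitions n)"
proof -
  interpret group "sym_group n" by (rule sym_group_is_group)
  show ?thesis
  proof (rule class_number_le_card[where f = "cycle_type {1..n}"])
    show "cycle_type {1..n} ` carrier (sym_group n) \<subseteq> partitions n"
      using cycle_type_in_partitions[of _ "{1..n}"] by (auto simp: sym_group_carrier)
    fix p q assume pq: "p \<in> carrier (sym_group n)" "q \<in> carrier (sym_group n)"
      "cycle_type {1..n} p = cycle_type {1..n} q"
    then obtain h where h: "h permutes {1..n}" "h \<circ> p = q \<circ> h"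
      using cycle_type_eq_imp_conjugate[of p "{1..n}" q] by (auto simp: sym_group_carrier)
    have "q = h \<circ> p \<circ> inv' h" using h permutes_inv_o(1)[OF h(1)] by (simp add: comp_assoc)
    then show "conj_rel p q"
      using h(1) unfolding conj_rel_def
      by (intro bexI[of _ h]) (simp_all add: sym_group_carrier sym_group_mult)
  qed (rule finite_partitions)
qed

text \<open>A class of \<open>A\<^sub>n\<close> is determined by its cycle type together with whether its elements are
  conjugate by an even permutation to a chosen representative of that type: if two elements are
  conjugate to it by odd permutations only, then the two odd permutations combine to an even one.\<close>

lemma class_number_alt_group_le: "class_number (alt_group n) \<le> 2 * card (partitions n)"
proof -
  interpret group "alt_group n" by (rule alt_group_is_group)
  let ?t = "cycle_type {1..n}"
  define r where "r t = (SOME p. p \<in> carrier (alt_group n) \<and> ?t p = t)" for t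
  \<comment> \<open>\<open>A p h\<close> says that \<open>h\<close> conjugates \<open>p\<close> to
    the representative of its cycle type; the flag in \<open>f\<close> records whether an even such
    \<open>h\<close> exists.\<close>
  define A where "A p h \<longleftrightarrow> h permutes {1..n} \<and> h \<circ> p = r (?t p) \<circ> h" for p h
  define f where "f p = (?t p, \<exists>h. A p h \<and> evenperm h)" for p
  have "class_number (alt_group n) \<le> card (partitions n \<times> (UNIV :: bool set))"
  proof (rule class_number_le_card[where f = f])
    show "f ` carrier (alt_group n) \<subseteq> partitions n \<times> UNIV"
      using cycle_type_in_partitions[of _ "{1..n}"] by (auto simp: alt_group_carrier f_def)
    fix p q assume pq: "p \<in> carrier (alt_group n)" "q \<in> carrier (alt_group n)" "f p = f q"
    then have t: "?t p = ?t q" by (simp add: f_def)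
    have ex: "\<exists>h. A x h" if x: "x \<in> carrier (alt_group n)" for x
    proof -
      have "r (?t x) \<in> carrier (alt_group n) \<and> ?t (r (?t x)) = ?t x"
        unfolding r_def by (rule someI[of _ x]) (simp add: x)
      then show ?thesis
        using cycle_type_eq_imp_conjugate[of x "{1..n}" "r (?t x)"] x
        unfolding A_def by (metis alt_group_carrier finite_atLeastAtMost)
    qed
    \<comment> \<open>Equal flags give \<open>h\<close> and \<open>k\<close> of equal parity: both
      even if the flags hold, and otherwise every choice is odd.\<close>
    obtain h k where hk: "A p h" "A q k" "evenperm h = evenperm k"
    proof -
      have "(\<exists>h. A p h \<and> evenperm h) \<longleftrightarrow> (\<exists>h. A q h \<and> evenperm h)" using pq(3) by (simp add: f_def)
      then show thesis using that ex[OF pq(1)] ex[OF pq(2)] by blast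
    qed
    have perm: "h permutes {1..n}" "k permutes {1..n}" using hk by (auto simp: A_def)
    define g where "g = inv' k \<circ> h"
    have g: "g permutes {1..n}" unfolding g_def using perm by (intro permutes_compose permutes_inv)
    have "permutation h" "permutation k" using perm by (auto simp: permutation_permutes)
    then have "evenperm g"
      using hk(3) unfolding g_def by (simp add: evenperm_comp evenperm_inv permutation_inverse)
    then have gA: "g \<in> carrier (alt_group n)" using g by (simp add: alt_group_carrier)
    have "k \<circ> (g \<circ> p) = h \<circ> p"
      unfolding g_def using permutes_inv_o(1)[OF perm(2)] by (simp flip: comp_assoc)
    also have "\<dots> = r (?t q) \<circ> h" using hk(1) t by (simp add: A_def)
    also have "\<dots> = r (?t q) \<circ> k \<circ> g"
      unfolding g_def using permutes_inv_o(1)[OF perm(2)] by (metis comp_assoc comp_id id_comp)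
    also have "\<dots> = k \<circ> (q \<circ> g)" using hk(2) unfolding A_def by (metis comp_assoc)
    finally have "g \<circ> p = q \<circ> g"
      using permutes_inj[OF perm(2)] by (simp add: fun_eq_iff inj_eq)
    then have "q = g \<circ> p \<circ> inv' g" using permutes_inv_o(1)[OF g] by (simp add: comp_assoc)
    then show "conj_rel p q"
      using gA unfolding conj_rel_def
      by (intro bexI[of _ g]) (simp_all add: alt_group_mult alt_group_inv_equality)
  qed (simp add: finite_partitions)
  then show ?thesis by (simp add: card_cartesian_product)
qed

section \<open>The primorial\<close>

text \<open>The entries \<open>L(n, k) = 1 / ((n + 1) (n choose k))\<close> of Leibniz's harmonic triangle satisfy
  \<open>L(n, k + 1) = L(n - 1, k) - L(n, k)\<close>, so they remain integral after multiplication by \<open>D\<close>.\<close>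

lemma Suc_mult_binomial_dvd:
  fixes D :: nat
  assumes "k \<le> n" "\<And>m. \<lbrakk>1 \<le> m; m \<le> Suc n\<rbrakk> \<Longrightarrow> m dvd D"
  shows "Suc n * (n choose k) dvd D"
  using assms
proof (induction k arbitrary: n)
  case 0
  then show ?case by simp
next
  case (Suc k)
  define c where "c = int (n choose k)"
  have "int n - int k \<noteq> 0" "n \<ge> 1" using Suc.prems(1) by auto
  have "Suc n * (n choose k) dvd D" using Suc by simp
  then have "int (Suc n * (n choose k)) dvd int D" by (simp only: int_dvd_int_iff)
  then obtain a where a: "int D = (int n + 1) * c * a"
    unfolding c_def by (auto elim!: dvdE simp: algebra_simps)
  have "Suc (n - 1) * ((n - 1) choose k) dvd D" using Suc.prems by (intro Suc.IH) auto
  moreover have "Suc (n - 1) * ((n - 1) choose k) = (n - k) * (n choose k)"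
    using binomial_absorb_comp[of "n" k] Suc.prems(1) by simp
  ultimately have "int ((n - k) * (n choose k)) dvd int D" by (metis int_dvd_int_iff)
  then obtain b where b: "int D = (int n - int k) * c * b"
    unfolding c_def using Suc.prems(1) by (auto elim!: dvdE)
  have "Suc k * (n choose Suc k) = (n - k) * (n choose k)"
    using binomial_absorption[of k "n"] binomial_absorb_comp[of n k] by simp
  then have "int (Suc k * (n choose Suc k)) = int ((n - k) * (n choose k))" by (simp only:)
  then have C: "(int k + 1) * int (n choose Suc k) = (int n - int k) * c"
    unfolding c_def using Suc.prems(1) by (simp add: of_nat_diff algebra_simps)
  \<comment> \<open>Here \<open>a\<close> and \<open>b\<close> are \<open>D\<close> times the
    entries \<open>L(n, k)\<close> and \<open>L(n - 1, k)\<close>, so \<open>b - a\<close> is the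
    cofactor wanted for \<open>L(n, k + 1)\<close>. The integers make this difference safe.\<close>
  have "(int k + 1) * ((int n + 1) * int (n choose Suc k) * (b - a))
      = (int n + 1) * ((int n - int k) * c * b) - (int n - int k) * ((int n + 1) * c * a)"
    using C by algebra
  also have "\<dots> = (int k + 1) * int D"
    unfolding a[symmetric] b[symmetric] by (simp add: algebra_simps)
  finally have "int D = (int n + 1) * int (n choose Suc k) * (b - a)" by simp
  then have "int D = int (Suc n * (n choose Suc k)) * (b - a)" by (simp add: algebra_simps)
  then have "int (Suc n * (n choose Suc k)) dvd int D" by (rule dvdI)
  then show ?case by (simp only: int_dvd_int_iff)
qed

text \<open>Row \<open>n\<close> of Pascal's triangle sums to \<open>2 ^ n\<close> and has
  \<open>Suc n\<close> entries, none above the central one; \<open>Suc n\<close> times that entry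
  divides the lcm.\<close>

lemma power_2_le_Lcm: "2 ^ n \<le> (Lcm {1..Suc n} :: nat)"
proof -
  have "2 ^ n = (\<Sum>k\<le>n. n choose k)" by (simp add: choose_row_sum)
  also have "\<dots> \<le> (\<Sum>k\<le>n. n choose (n div 2))" by (intro sum_mono binomial_maximum)
  also have "\<dots> = Suc n * (n choose (n div 2))" by simp
  also have "\<dots> \<le> Lcm {1..Suc n}"
  proof (rule dvd_imp_le)
    show "Suc n * (n choose (n div 2)) dvd Lcm {1..Suc n}"
      by (intro Suc_mult_binomial_dvd dvd_Lcm) auto
    show "Lcm {1..Suc n} > 0" by (intro Nat.gr0I) (simp add: Lcm_0_iff)
  qed
  finally show ?thesis .
qed

text \<open>The exponent in an lcm is a maximum, so the prime power already divides one of the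
  numbers up to \<open>n\<close>.\<close>

lemma prime_power_multiplicity_Lcm_le:
  fixes p :: nat
  assumes "prime p" "n \<ge> 1"
  shows "p ^ multiplicity p (Lcm {1..n}) \<le> n"
  using assms(2)
proof (induction n rule: dec_induct)
  case base
  then show ?case by simp
next
  case (step n)
  have "Lcm {1..Suc n} = lcm (Suc n) (Lcm {1..n})" by (simp add: atLeastAtMostSuc_conv)
  moreover have "Lcm {1..n} \<noteq> 0" by (simp add: Lcm_0_iff)
  ultimately have "multiplicity p (Lcm {1..Suc n})
      = max (multiplicity p (Suc n)) (multiplicity p (Lcm {1..n}))"
    using assms(1) by (simp add: multiplicity_lcm)
  moreover have "p ^ multiplicity p (Suc n) \<le> Suc n" by (intro dvd_imp_le multiplicity_dvd) simp
  ultimately show ?case using step.IH by (auto simp: max_def)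
qed

definition primorial :: "nat \<Rightarrow> nat" where
  "primorial n = (\<Prod>p | prime p \<and> p \<le> n. p)"

text \<open>Every prime power in the lcm is at most \<open>n\<close>, and for
  \<open>p\<^sup>2 > n\<close> its exponent is at most 1. Only primes with
  \<open>p\<^sup>2 \<le> n\<close> therefore need an extra factor beyond \<open>p\<close>, and
  \<open>n\<close> suffices.\<close>

lemma Lcm_le_primorial:
  assumes "n \<ge> 1"
  shows "Lcm {1..n} \<le> primorial n * n ^ card {p. prime p \<and> p\<^sup>2 \<le> n}"
proof -
  define L where "L = (Lcm {1..n} :: nat)"
  define f where "f p = (if p\<^sup>2 \<le> n then n else 1)" for p :: nat
  have fin: "finite {p. prime p \<and> p \<le> n}" by simp
  have "L \<noteq> 0" unfolding L_def by (simp add: Lcm_0_iff)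
  have small: "p ^ multiplicity p L \<le> n" if "prime p" for p
    unfolding L_def using that assms by (rule prime_power_multiplicity_Lcm_le)
  have factor: "p ^ multiplicity p L \<le> p * f p" if p: "prime p" for p
  proof (cases "p\<^sup>2 \<le> n")
    case True
    then have "f p = n" by (simp add: f_def)
    then show ?thesis using small[OF p] prime_ge_1_nat[OF p]
      by (metis mult_le_mono mult_1)
  next
    case False
    have "multiplicity p L \<le> 1"
    proof (rule ccontr)
      assume "\<not> multiplicity p L \<le> 1"
      then have "p\<^sup>2 \<le> p ^ multiplicity p L"
        using prime_ge_1_nat[OF p] by (intro power_increasing) auto
      then show False using small[OF p] False by linarith
    qed
    then have "p ^ multiplicity p L \<le> p ^ 1"
      using prime_ge_1_nat[OF p] by (intro power_increasing) auto
    then show ?thesis using False by (simp add: f_def)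
  qed
  have sub: "prime_factors L \<subseteq> {p. prime p \<and> p \<le> n}"
  proof
    fix p assume "p \<in> prime_factors L"
    then have p: "prime p" "multiplicity p L > 0"
      by (auto simp: prime_factors_multiplicity)
    then have "p ^ 1 \<le> p ^ multiplicity p L"
      using prime_ge_1_nat[OF p(1)] by (intro power_increasing) auto
    then show "p \<in> {p. prime p \<and> p \<le> n}" using small[OF p(1)] p(1) by simp
  qed
  have "L = (\<Prod>p\<in>prime_factors L. p ^ multiplicity p L)"
    using \<open>L \<noteq> 0\<close> by (simp add: prime_factorization_nat)
  also have "\<dots> \<le> (\<Prod>p | prime p \<and> p \<le> n. p ^ multiplicity p L)"
    using sub fin by (intro dvd_imp_le prod_dvd_prod_subset) (auto simp: prime_gt_0_nat)
  also have "\<dots> \<le> (\<Prod>p | prime p \<and> p \<le> n. p * f p)"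
    by (intro prod_mono) (auto simp: factor)
  also have "\<dots> = primorial n * (\<Prod>p | prime p \<and> p \<le> n. f p)"
    by (simp add: prod.distrib primorial_def)
  also have "(\<Prod>p | prime p \<and> p \<le> n. f p) = (\<Prod>p | prime p \<and> p\<^sup>2 \<le> n. n)"
    using fin by (intro prod.mono_neutral_cong_right)
      (auto simp: f_def intro: order_trans[OF power2_nat_le_imp_le] dest: power2_nat_le_imp_le)
  finally show ?thesis by (simp add: L_def)
qed

text \<open>The primes in question are 2 or odd; also discarding \<open>9 = 2 * 4 + 1\<close> is what makes the estimate
  good enough to leave only \<open>n < 168\<close> for explicit primes.\<close>

lemma card_primes_square_le:
  fixes n :: nat
  assumes "n \<ge> 81"
  shows "2 * real (card {p. prime p \<and> p\<^sup>2 \<le> n}) \<le> sqrt n - 1"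
proof -
  define m where "m = nat \<lfloor>(sqrt n - 1) / 2\<rfloor>"
  have "sqrt (9\<^sup>2) \<le> sqrt n" using assms by (intro real_sqrt_le_mono) simp
  then have "sqrt n \<ge> 9" by simp
  \<comment> \<open>This puts 4 in \<open>{1..m}\<close>, so that removing it offsets the insertion
    of the prime 2 and the count is exactly \<open>m\<close>.\<close>
  then have m: "m \<ge> 4" unfolding m_def by (intro le_nat_floor) simp
  have "{p. prime p \<and> p\<^sup>2 \<le> n} \<subseteq> insert 2 ((\<lambda>k. 2 * k + 1) ` ({1..m} - {4}))"
  proof
    fix p assume "p \<in> {p. prime p \<and> p\<^sup>2 \<le> n}"
    then have p: "prime p" "p\<^sup>2 \<le> n" by auto
    show "p \<in> insert 2 ((\<lambda>k. 2 * k + 1) ` ({1..m} - {4}))"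
    proof (cases "p = 2")
      case False
      with p(1) have "odd p" using primes_dvd_imp_eq two_is_prime_nat by blast
      then obtain k where k: "p = 2 * k + 1" by (auto elim: oddE)
      have "k \<ge> 1" using k p(1) by (cases k) auto
      moreover have "k \<noteq> 4" using k p(1) by auto
      moreover have "k \<le> m"
      proof -
        have "real p \<le> sqrt n" using p(2)
          by (intro real_le_rsqrt) (metis of_nat_le_iff of_nat_power)
        then have "real k \<le> (sqrt n - 1) / 2" by (simp add: k)
        then show ?thesis unfolding m_def by (simp add: le_nat_floor)
      qed
      ultimately show ?thesis using k by auto
    qed simp
  qed
  then have "card {p. prime p \<and> p\<^sup>2 \<le> n} \<le> card (insert 2 ((\<lambda>k. 2 * k + 1) ` ({1..m} - {4})))"
    by (intro card_mono) auto
  also have "\<dots> \<le> Suc (card ({1..m} - {4}))"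
    using card_image_le[of "{1..m} - {4}" "\<lambda>k. 2 * k + 1"] by (simp add: card_insert_if)
  also have "\<dots> = m" using m by simp
  finally have "real (card {p. prime p \<and> p\<^sup>2 \<le> n}) \<le> real m" by linarith
  moreover have "real m \<le> (sqrt n - 1) / 2"
    unfolding m_def using assms by (intro of_nat_floor) simp
  ultimately show ?thesis by (simp add: mult.commute)
qed

section \<open>Fibonacci numbers against the primorial\<close>

text \<open>The base \<open>81/50\<close> is slightly above the golden ratio and satisfies \<open>(81/50)^10 < 2^7\<close>.\<close>

lemma fib_Suc_le_power: "real (fib (Suc n)) \<le> (81/50) ^ n"
proof (induction n rule: fib.induct)
  case (3 n)
  have "real (fib (Suc (Suc (Suc n)))) \<le> (81/50) ^ Suc n + (81/50) ^ n"
    using 3 by simp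
  \<comment> \<open>The square of \<open>81/50\<close> is 2.6244, just above
    \<open>81/50 + 1 = 2.62\<close>.\<close>
  also have "\<dots> \<le> (81/50) ^ Suc (Suc n)" by simp
  finally show ?case .
qed auto

text \<open>After taking logarithms, \<open>n * ln (81/50)\<close> uses up at most
  \<open>7/10 * n\<close> of the \<open>n - 1\<close> available multiples of \<open>ln 2\<close>.
  One more goes to the factor 2, which leaves \<open>3/10 * n - 2\<close> for
  \<open>c * ln n\<close>.\<close>

lemma double_power_le_primorial_large:
  assumes "n \<ge> 168"
  shows "2 * (81/50) ^ n \<le> real (primorial n)"
proof -
  define s where "s = sqrt (real n)"
  define c where "c = card {p. prime p \<and> p\<^sup>2 \<le> n}"
  have n: "n \<ge> 1" "real n = s\<^sup>2" using assms by (auto simp: s_def)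
  \<comment> \<open>The square of \<open>64/5\<close> is 163.84, just below 168.\<close>
  have "sqrt ((64/5)\<^sup>2) \<le> s"
    unfolding s_def using assms by (intro real_sqrt_le_mono) (simp add: power2_eq_square)
  then have s: "s \<ge> 64/5" by simp
  have ln2: "2/3 \<le> ln (2::real)" by (rule ln2_ge_two_thirds)
  \<comment> \<open>the tangent to \<open>ln\<close> at 8 turns the claim into a quadratic inequality in \<open>s\<close>\<close>
  have "ln (s / 8) \<le> s / 8 - 1" using s by (intro ln_le_minus_one) auto
  \<comment> \<open>The factor \<open>ln 2 * 3/2\<close> is at least 1 and makes every term a
    multiple of \<open>ln 2\<close>.\<close>
  also have "\<dots> \<le> (s / 8 - 1) * (ln 2 * 3/2)"
    using mult_left_mono[of 1 "ln 2 * 3/2" "s / 8 - 1"] s ln2 by simp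
  finally have "ln s \<le> ln 8 + (s / 8 - 1) * (ln 2 * 3/2)"
    using s by (simp add: ln_div field_simps)
  moreover have "ln (8::real) = 3 * ln 2" using ln_realpow[of 2 3] by simp
  ultimately have lns: "ln s \<le> (3/2 + 3/16 * s) * ln 2" by (simp add: field_simps)
  have "real c \<le> (s - 1) / 2"
    using card_primes_square_le[of n] assms by (simp add: c_def s_def)
  then have "real c * ln n \<le> (s - 1) / 2 * (2 * ((3/2 + 3/16 * s) * ln 2))"
    using lns s by (intro mult_mono) (auto simp: n(2) ln_realpow)
  also have "\<dots> = ((s - 1) * (3/2 + 3/16 * s)) * ln 2" by simp
  also have "\<dots> \<le> (3/10 * s\<^sup>2 - 2) * ln 2"
  proof (intro mult_right_mono)
    \<comment> \<open>The quadratic difference is split into summands that are visibly nonnegative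
      for \<open>s \<ge> 64/5\<close>.\<close>
    have "0 \<le> (s - 64/5) * (9/80 * s + 1/10) + (11/400 * s + 39/50)" using s by simp
    also have "\<dots> = (3/10 * s\<^sup>2 - 2) - (s - 1) * (3/2 + 3/16 * s)"
      by (simp add: field_simps power2_eq_square)
    finally show "(s - 1) * (3/2 + 3/16 * s) \<le> 3/10 * s\<^sup>2 - 2" by simp
  qed simp
  finally have c: "real c * ln n \<le> (3/10 * n - 2) * ln 2" by (simp add: n(2))
  have "10 * ln (81/50 :: real) = ln ((81/50) ^ 10)" by (subst ln_realpow) simp_all
  also have "\<dots> \<le> ln (2 ^ 7)" by (subst ln_le_cancel_iff) (simp_all add: field_simps)
  also have "\<dots> = 7 * ln (2::real)" by (subst ln_realpow) simp_all
  finally have "real n * ln (81/50) \<le> real n * (7/10 * ln 2)" by (intro mult_left_mono) auto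
  with c have "ln 2 + real n * ln (81/50) + real c * ln n \<le> (real n - 1) * ln 2"
    by (simp add: algebra_simps)
  moreover have "ln (2 * (81/50) ^ n * real n ^ c) = ln 2 + real n * ln (81/50) + real c * ln n"
    using n(1) by (simp add: ln_mult ln_realpow)
  moreover have "ln (2 ^ (n - 1)) = (real n - 1) * ln (2::real)"
    using n(1) by (subst ln_realpow) (simp_all add: of_nat_diff)
  ultimately have "2 * (81/50) ^ n * real n ^ c \<le> 2 ^ (n - 1)"
    using n(1) by (subst ln_le_cancel_iff[symmetric]) auto
  also have "\<dots> \<le> real (primorial n * n ^ c)"
  proof -
    have "2 ^ (n - 1) \<le> primorial n * n ^ c"
      using power_2_le_Lcm[of "n - 1"] Lcm_le_primorial[OF n(1)] n(1) by (simp add: c_def)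
    then show ?thesis by (metis of_nat_le_iff of_nat_numeral of_nat_power)
  qed
  finally show ?thesis using n(1) by simp
qed

lemma prod_list_primes_le_primorial:
  assumes "distinct ps" "\<forall>p\<in>set ps. prime p \<and> p \<le> n"
  shows "prod_list ps \<le> primorial n"
proof -
  have "prod_list ps = \<Prod> (set ps)"
    using assms(1) by (simp add: prod.distinct_set_conv_list)
  also have "\<dots> \<le> primorial n"
    unfolding primorial_def using assms(2)
    by (intro dvd_imp_le prod_dvd_prod_subset) (auto simp: prime_gt_0_nat)
  finally show ?thesis .
qed

text \<open>On a block from \<open>a\<close> to \<open>b\<close> the power is largest at
  \<open>b\<close>, while the primes up to \<open>a\<close> are available throughout, so one
  numerical check covers the block.\<close>

lemma double_power_le_primorial_between:
  assumes "a \<le> n" "n \<le> b" "distinct ps" "\<forall>p\<in>set ps. prime p \<and> p \<le> a"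
    and "2 * 81 ^ b \<le> prod_list ps * 50 ^ b"
  shows "2 * (81/50) ^ n \<le> real (primorial n)"
proof -
  have "2 * (81/50) ^ n \<le> 2 * (81/50 :: real) ^ b"
    using assms(2) by (intro mult_left_mono power_increasing) auto
  also have "\<dots> \<le> real (prod_list ps)"
  proof -
    have "real (2 * 81 ^ b) \<le> real (prod_list ps * 50 ^ b)" using assms(5) by (simp only: of_nat_le_iff)
    then show ?thesis by (simp add: power_divide divide_simps)
  qed
  also have "\<dots> \<le> real (primorial n)"
    using prod_list_primes_le_primorial[of ps n] assms(1,3,4) by force
  finally show ?thesis .
qed

lemma double_power_le_primorial:
  assumes "n \<ge> 11"
  shows "2 * (81/50) ^ n \<le> real (primorial n)"
proof -
  \<comment> \<open>Each block starts at a prime, and its list contains all primes up to that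
    start.\<close>
  consider "n \<ge> 168" | "11 \<le> n" "n \<le> 13" | "13 \<le> n" "n \<le> 19" | "19 \<le> n" "n \<le> 23"
    | "23 \<le> n" "n \<le> 37" | "37 \<le> n" "n \<le> 59" | "59 \<le> n" "n \<le> 97" | "97 \<le> n" "n \<le> 167"
    using assms by linarith
  then show ?thesis
  proof cases
    case 1 then show ?thesis by (rule double_power_le_primorial_large)
  next
    case 2 then show ?thesis
      by (rule double_power_le_primorial_between[where ps = "[2,3,5,7,11]"]) simp_all
  next
    case 3 then show ?thesis
      by (rule double_power_le_primorial_between[where ps = "[2,3,5,7,11,13]"]) simp_all
  next
    case 4 then show ?thesis
      by (rule double_power_le_primorial_between[where ps = "[2,3,5,7,11,13,17,19]"]) simp_all
  next
    case 5 then show ?thesis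
      by (rule double_power_le_primorial_between[where ps = "[2,3,5,7,11,13,17,19,23]"])
        simp_all
  next
    case 6 then show ?thesis
      by (rule double_power_le_primorial_between[where ps = "[2,3,5,7,11,13,17,19,23,29,31,37]"])
        simp_all
  next
    case 7 then show ?thesis
      by (rule double_power_le_primorial_between
            [where ps = "[2,3,5,7,11,13,17,19,23,29,31,37,41,43,47,53,59]"])
        simp_all
  next
    case 8 then show ?thesis
      by (rule double_power_le_primorial_between
            [where ps = "[2,3,5,7,11,13,17,19,23,29,31,37,41,43,47,53,59,61,67,71,73,79,83,89,97]"])
        simp_all
  qed
qed

lemma double_fib_le_primorial:
  assumes "n \<ge> 5"
  shows "2 * fib (Suc n) \<le> primorial n"
proof (cases "n \<ge> 11")
  case True
  have "real (2 * fib (Suc n)) \<le> real (primorial n)"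
    using fib_Suc_le_power[of n] double_power_le_primorial[OF True] by simp
  then show ?thesis by linarith
next
  case False
  show ?thesis
  proof (cases "n \<ge> 7")
    case True
    \<comment> \<open>At \<open>n = 10\<close> the power bound would give about 249, above 210; the
      exact value is \<open>2 * 89 = 178\<close>.\<close>
    have "2 * fib (Suc n) \<le> 2 * fib 11" using False by (simp add: fib_mono)
    also have "\<dots> \<le> prod_list [2,3,5,7]" by (simp add: eval_nat_numeral)
    also have "\<dots> \<le> primorial n"
      using True by (intro prod_list_primes_le_primorial) simp_all
    finally show ?thesis .
  next
    case False
    have "2 * fib (Suc n) \<le> 2 * fib 7" using False by (simp add: fib_mono)
    also have "\<dots> \<le> prod_list [2,3,5]" by (simp add: eval_nat_numeral)
    also have "\<dots> \<le> primorial n"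
      using assms by (intro prod_list_primes_le_primorial) simp_all
    finally show ?thesis .
  qed
qed

text \<open>Without the factor 2 the bound extends down to \<open>n = 1\<close>: the values 1, 2 and
  5 face 1, 2 and 6.\<close>

lemma fib_le_primorial:
  assumes "n \<ge> 1"
  shows "fib (Suc n) \<le> primorial n"
proof -
  consider "n \<ge> 5" | "3 \<le> n" "n \<le> 4" | "n = 2" | "n = 1" using assms by linarith
  then show ?thesis
  proof cases
    case 1 then show ?thesis using double_fib_le_primorial[of n] by linarith
  next
    case 2
    then have "fib (Suc n) \<le> fib 5" by (simp add: fib_mono)
    also have "\<dots> \<le> prod_list [2,3]" by (simp add: eval_nat_numeral)
    also have "\<dots> \<le> primorial n"
      using 2 by (intro prod_list_primes_le_primorial) simp_all
    finally show ?thesis .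
  next
    case 3
    then show ?thesis using prod_list_primes_le_primorial[of "[2]" n] by (simp add: numeral_3_eq_3)
  next
    case 4
    then show ?thesis using prod_list_primes_le_primorial[of "[]" n] by simp
  qed
qed

section \<open>The product of the Sylow class numbers\<close>

lemma prime_dvd_order_sym_group:
  fixes p :: nat
  assumes "prime p"
  shows "p dvd order (sym_group n) \<longleftrightarrow> p \<le> n"
  using assms by (simp add: order_def sym_group_card_carrier prime_dvd_fact_iff)

text \<open>Halving \<open>fact n\<close> can only affect the prime 2, and a factor 2 survives
  because 4 divides \<open>fact n\<close>.\<close>

lemma prime_dvd_order_alt_group:
  fixes p :: nat
  assumes "prime p" "n \<ge> 4"
  shows "p dvd order (alt_group n) \<longleftrightarrow> p \<le> n"
proof -
  have *: "2 * order (alt_group n) = fact n"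
    using alt_group_card_carrier[of n] assms(2) by (simp add: order_def)
  show ?thesis
  proof (cases "p = 2")
    case True
    have "2 * 2 dvd 2 * order (alt_group n)"
      unfolding * using dvd_fact[of 4 n] assms(2) by simp
    then show ?thesis using True assms(2) by simp
  next
    case False
    then have "\<not> p dvd 2" using assms(1) primes_dvd_imp_eq two_is_prime_nat by blast
    then have "p dvd order (alt_group n) \<longleftrightarrow> p dvd 2 * order (alt_group n)"
      using assms(1) by (simp add: prime_dvd_mult_iff)
    then show ?thesis unfolding * using assms(1) by (simp add: prime_dvd_fact_iff)
  qed
qed

lemma (in group) primorial_le_prod_sylow_class_number:
  assumes "finite (carrier G)" "\<And>p. prime p \<Longrightarrow> p dvd order G \<longleftrightarrow> p \<le> n"
  shows "primorial n \<le> (\<Prod>p | prime p \<and> p dvd order G. sylow_class_number p G)"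
proof -
  have "{p. prime p \<and> p dvd order G} = {p. prime p \<and> p \<le> n}" using assms(2) by blast
  then show ?thesis
    unfolding primorial_def using prime_le_sylow_class_number[OF assms(1)]
    by (auto intro!: prod_mono simp flip: assms(2))
qed

lemma class_number_sym_group_le_prod:
  assumes "n \<ge> 1"
  shows "class_number (sym_group n)
    \<le> (\<Prod>p | prime p \<and> p dvd order (sym_group n). sylow_class_number p (sym_group n))"
proof -
  have "class_number (sym_group n) \<le> primorial n"
    using class_number_sym_group_le card_partitions_le_fib fib_le_primorial[OF assms]
    by (blast intro: order_trans)
  also have "\<dots> \<le> (\<Prod>p | prime p \<and> p dvd order (sym_group n). sylow_class_number p (sym_group n))"
    by (intro group.primorial_le_prod_sylow_class_number sym_group_is_group
        finite_carrier_sym_group prime_dvd_order_sym_group)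
  finally show ?thesis .
qed

text \<open>The primorial 6 is below the Fibonacci bound 10. The abelian Sylow 2-subgroup
  contributes 4 instead of 2, so the product is at least \<open>4 * 3 = 12\<close>, the order of the
  group.\<close>

lemma class_number_alt_group_4_le_prod:
  "class_number (alt_group 4)
    \<le> (\<Prod>p | prime p \<and> p dvd order (alt_group 4). sylow_class_number p (alt_group 4))"
proof -
  interpret group "alt_group 4" by (rule alt_group_is_group)
  note fin = finite_carrier_alt_group[of 4]
  have ord: "order (alt_group 4) = 12"
    using alt_group_card_carrier[of 4] by (simp add: order_def fact_numeral)
  obtain P where P: "group (alt_group 4\<lparr>carrier := P\<rparr>)"
    "order (alt_group 4\<lparr>carrier := P\<rparr>) = 2 ^ multiplicity 2 (order (alt_group 4))"
    "sylow_class_number 2 (alt_group 4) = class_number (alt_group 4\<lparr>carrier := P\<rparr>)"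
    using fin two_is_prime_nat by (rule sylow_class_number_witness)
  have "multiplicity 2 (12 :: nat) = 2" by (rule multiplicity_eqI) simp_all
  then have P4: "order (alt_group 4\<lparr>carrier := P\<rparr>) = 4" using P(2) ord by simp
  then have "finite (carrier (alt_group 4\<lparr>carrier := P\<rparr>))"
    unfolding order_def by (intro card_ge_0_finite) simp
  then have "sylow_class_number 2 (alt_group 4) = 4"
    using group.comm_imp_class_number_eq_order[OF P(1)] group.order_le_4_imp_comm[OF P(1)] P(3) P4
    by simp
  moreover have "3 \<le> sylow_class_number 3 (alt_group 4)"
    by (rule prime_le_sylow_class_number[OF fin]) (simp_all add: ord)
  moreover have "{p. prime p \<and> p dvd order (alt_group 4)} = {2, 3}"
  proof -
    have "p = 2 \<or> p = 3" if "prime p" "p \<le> 4" for p :: nat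
    proof -
      have "p \<noteq> 4" using that(1) by auto
      then show ?thesis using prime_ge_2_nat[OF that(1)] that(2) by linarith
    qed
    then show ?thesis using prime_dvd_order_alt_group[of _ 4] by auto
  qed
  ultimately show ?thesis using class_number_le_order[OF fin] ord by simp
qed

lemma class_number_alt_group_le_prod:
  "class_number (alt_group n)
    \<le> (\<Prod>p | prime p \<and> p dvd order (alt_group n). sylow_class_number p (alt_group n))"
proof -
  interpret group "alt_group n" by (rule alt_group_is_group)
  note fin = finite_carrier_alt_group[of n]
  note sylow = prime_le_sylow_class_number[OF fin]
  consider "n \<ge> 5" | "n = 4" | "n = 3" | "n \<le> 2" by linarith
  then show ?thesis
  proof cases
    case 1
    have "class_number (alt_group n) \<le> primorial n"
      using class_number_alt_group_le[of n] card_partitions_le_fib[of n] double_fib_le_primorial[OF 1]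
      by linarith
    also have "\<dots> \<le> (\<Prod>p | prime p \<and> p dvd order (alt_group n). sylow_class_number p (alt_group n))"
      using 1 by (intro primorial_le_prod_sylow_class_number fin prime_dvd_order_alt_group) auto
    finally show ?thesis .
  next
    case 2
    then show ?thesis using class_number_alt_group_4_le_prod by simp
  next
    case 3
    then have ord: "order (alt_group n) = 3"
      using alt_group_card_carrier[of 3] by (simp add: order_def fact_numeral)
    have "prime (3 :: nat)" by simp
    then have "{p. prime p \<and> p dvd order (alt_group n)} = {3}"
      unfolding ord using primes_dvd_imp_eq[of _ "3 :: nat"] by auto
    then show ?thesis using class_number_le_order[OF fin] sylow[of 3] ord by simp
  next
    case 4
    have "order (alt_group n) = 1"
    proof (cases "n = 2")
      case True
      then show ?thesis using alt_group_card_carrier[of 2] by (simp add: order_def)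
    next
      case False
      \<comment> \<open>For \<open>n \<le> 1\<close> the set \<open>{1..n}\<close> has at most one
        point, so only the identity permutes it.\<close>
      then have "carrier (alt_group n) \<subseteq> {id}"
        using 4 by (auto simp: alt_group_carrier le_Suc_eq numeral_2_eq_2)
      then show ?thesis using one_closed unfolding order_def by (simp add: subset_singleton_iff) auto
    qed
    then have "class_number (alt_group n) \<le> 1" using class_number_le_order[OF fin] by simp
    also have "1 \<le> (\<Prod>p | prime p \<and> p dvd order (alt_group n). sylow_class_number p (alt_group n))"
      by (intro prod_ge_1) (metis (mono_tags) mem_Collect_eq order_trans prime_ge_1_nat sylow)
    finally show ?thesis .
  qed
qed

theorem theorem2p5:
  fixes n :: nat
  assumes "n \<ge> 1"
  shows "class_number (sym_group n)
           \<le> (\<Prod>p \<in> {p. prime p \<and> p dvd order (sym_group n)}. sylow_class_number p (sym_group n))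
       \<and> class_number (alt_group n)
           \<le> (\<Prod>p \<in> {p. prime p \<and> p dvd order (alt_group n)}. sylow_class_number p (alt_group n))"
  using class_number_sym_group_le_prod[OF assms] class_number_alt_group_le_prod[of n] by simp

end
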